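(* Let $R$ be a finite ring with identity, let $\mathcal{A}$ be a finite Frobenius $R$-$R$ bimodule, and let $\mathbf{w}$ be the homogeneous weight on $\mathcal{A}$ with average value $\gamma>0$, extended additively to $\mathcal{A}^n$. Let $\sigma,\lambda,\delta$ be real numbers with $0<\delta$ and $0\le\lambda<\sigma\le1$. Then $$\alpha(\mathcal A:\sigma,\lambda,\delta)\le\begin{cases}0&\text{if }\delta>\gamma\sigma,\\ \sigma-\dfrac{\delta}{\gamma}&\text{if }\delta\le\gamma\sigma.\end{cases}$$
   Context: For a finite ring $R$, $\hat R=\mathrm{Hom}_{\mathbb Z}(R,\mathbb C^\times)$ is an $R$-$R$ bimodule via $({}^{r}\phi)(x)=\phi(xr)$, $(\phi^{r})(x)=\phi(rx)$. A finite $R$-$R$ bimodule $\mathcal A$ is Frobenius if $\mathcal A\cong\hat R$ both as left and as right $R$-modules. A weight $\mathbf w:\mathcal A\to\mathbb R$ with $\mathbf w(0)=0$ is homogeneous with average value $\gamma$ if $Rx=Ry$ implies $\mathbf w(x)=\mathbf w(y)$, and $\sum_{y\in Rx}\mathbf w(y)=\gamma|Rx|$ for all $0\ne x\in\mathcal A$; it is extended to $\mathcal A^n$ by $\mathbf w(c)=\sum_i\mathbf w(c_i)$. For $X\subseteq\mathcal A^n$, $\mathrm{supp}(X)=\{i:z_i\ne0\text{ for some }z\in X\}$. For an $R$-$R$ sub-bimodule $K$ of $\mathcal A^n$ the induced weight is $\hat{\mathbf w}(u+K)=\min\{\mathbf w(v):v\in u+K\}$, and the minimum distance of $C\subseteq\mathcal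 A^n/K$ is $\min\{\hat{\mathbf w}(x-y):x,y\in C,x\ne y\}$. $A(\mathcal A:n,s,\ell,d)$ is the maximum of $|C|$ over all $R$-$R$ sub-bimodules $K$ of $\mathcal A^n$ with $|\mathrm{supp}(K)|=\ell$ and all $C\subseteq\mathcal A^n/K$ with induced minimum distance $d$ and $|\mathrm{supp}(\bigcup_{x\in C}(x+K))|=s$. Then $\alpha(\mathcal A:\sigma,\lambda,\delta)=\limsup_{n\to\infty}n^{-1}\log_{|\mathcal A|}A(\mathcal A:n,\sigma n,\lambda n,\delta n)$. *)

theory Defs
  imports Complex_Main "HOL-Library.Extended_Real" "HOL-Library.Liminf_Limsup"
    "HOL-Library.Function_Algebras"
begin

text \<open>
  The finite ring is a type of classes finite and ring_1 (noncommutative, with 0 different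
  from 1). For the zero ring the only bimodule is 0, and logarithms to base 1 would be needed.
\<close>

locale bimodule =
  fixes lact :: "'r::{finite,ring_1} \<Rightarrow> 'a::{finite,ab_group_add} \<Rightarrow> 'a"
    and ract :: "'a \<Rightarrow> 'r \<Rightarrow> 'a"
  assumes lact_add_right: "lact r (x + y) = lact r x + lact r y"
    and lact_add_left: "lact (r + s) x = lact r x + lact s x"
    and lact_mult: "lact (r * s) x = lact r (lact s x)"
    and lact_one: "lact 1 x = x"
    and ract_add_left: "ract (x + y) r = ract x r + ract y r"
    and ract_add_right: "ract x (r + s) = ract x r + ract x s"
    and ract_mult: "ract x (r * s) = ract (ract x r) s"
    and ract_one: "ract x 1 = x"
    and act_assoc: "ract (lact r x) s = lact r (ract x s)"

definition characters :: "('r::ring_1 \<Rightarrow> complex) set" where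
  "characters = {\<phi>. (\<forall>x. \<phi> x \<noteq> 0) \<and> (\<forall>x y. \<phi> (x + y) = \<phi> x * \<phi> y)}"

definition char_lact :: "'r::ring_1 \<Rightarrow> ('r \<Rightarrow> complex) \<Rightarrow> 'r \<Rightarrow> complex" where
  "char_lact r \<phi> = (\<lambda>x. \<phi> (x * r))"

definition char_ract :: "('r::ring_1 \<Rightarrow> complex) \<Rightarrow> 'r \<Rightarrow> 'r \<Rightarrow> complex" where
  "char_ract \<phi> r = (\<lambda>x. \<phi> (r * x))"

text \<open>The group of characters is written multiplicatively, with the pointwise product.\<close>

locale frobenius_bimodule = bimodule lact ract
  for lact :: "'r::{finite,ring_1} \<Rightarrow> 'a::{finite,ab_group_add} \<Rightarrow> 'a"
    and ract :: "'a \<Rightarrow> 'r \<Rightarrow> 'a" +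
  assumes left_iso: "\<exists>f. bij_betw f UNIV (characters :: ('r \<Rightarrow> complex) set)
      \<and> (\<forall>a b. f (a + b) = (\<lambda>x. f a x * f b x))
      \<and> (\<forall>r a. f (lact r a) = char_lact r (f a))"
    and right_iso: "\<exists>f. bij_betw f UNIV (characters :: ('r \<Rightarrow> complex) set)
      \<and> (\<forall>a b. f (a + b) = (\<lambda>x. f a x * f b x))
      \<and> (\<forall>a r. f (ract a r) = char_ract (f a) r)"

definition homogeneous_weight ::
  "('r \<Rightarrow> 'a::zero \<Rightarrow> 'a) \<Rightarrow> ('a \<Rightarrow> real) \<Rightarrow> real \<Rightarrow> bool" where
  "homogeneous_weight lact w \<gamma> \<longleftrightarrow>
     w 0 = 0
     \<and> (\<forall>x y. range (\<lambda>r. lact r x) = range (\<lambda>r. lact r y) \<longrightarrow> w x = w y)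
     \<and> (\<forall>x. x \<noteq> 0 \<longrightarrow>
          (\<Sum>y\<in>range (\<lambda>r. lact r x). w y) = \<gamma> * real (card (range (\<lambda>r. lact r x))))"

text \<open>
  Since the length varies, the elements of the n-th power are the functions on the natural
  numbers that vanish from n on, with pointwise addition; the coordinates are 0, ..., n - 1.
\<close>

definition words :: "nat \<Rightarrow> (nat \<Rightarrow> 'a::zero) set" where
  "words n = {c. \<forall>i\<ge>n. c i = 0}"

definition weight :: "('a \<Rightarrow> real) \<Rightarrow> nat \<Rightarrow> (nat \<Rightarrow> 'a) \<Rightarrow> real" where
  "weight w n c = (\<Sum>i<n. w (c i))"

definition supp :: "nat \<Rightarrow> (nat \<Rightarrow> 'a::zero) set \<Rightarrow> nat set" where
  "supp n X = {i. i < n \<and> (\<exists>z\<in>X. z i \<noteq> 0)}"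

definition sub_bimodule ::
  "('r \<Rightarrow> 'a::ab_group_add \<Rightarrow> 'a) \<Rightarrow> ('a \<Rightarrow> 'r \<Rightarrow> 'a) \<Rightarrow> nat \<Rightarrow> (nat \<Rightarrow> 'a) set \<Rightarrow> bool" where
  "sub_bimodule lact ract n K \<longleftrightarrow>
     K \<subseteq> words n \<and> 0 \<in> K
     \<and> (\<forall>u\<in>K. \<forall>v\<in>K. u - v \<in> K)
     \<and> (\<forall>r. \<forall>u\<in>K. (\<lambda>i. lact r (u i)) \<in> K)
     \<and> (\<forall>r. \<forall>u\<in>K. (\<lambda>i. ract (u i) r) \<in> K)"

definition coset :: "(nat \<Rightarrow> 'a::ab_group_add) \<Rightarrow> (nat \<Rightarrow> 'a) set \<Rightarrow> (nat \<Rightarrow> 'a) set" where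
  "coset u K = (\<lambda>k. u + k) ` K"

definition quotient_words :: "nat \<Rightarrow> (nat \<Rightarrow> 'a::ab_group_add) set \<Rightarrow> (nat \<Rightarrow> 'a) set set" where
  "quotient_words n K = (\<lambda>u. coset u K) ` words n"

definition coset_diff ::
  "(nat \<Rightarrow> 'a::ab_group_add) set \<Rightarrow> (nat \<Rightarrow> 'a) set \<Rightarrow> (nat \<Rightarrow> 'a) set" where
  "coset_diff X Y = {u - v | u v. u \<in> X \<and> v \<in> Y}"

definition induced_weight :: "('a \<Rightarrow> real) \<Rightarrow> nat \<Rightarrow> (nat \<Rightarrow> 'a) set \<Rightarrow> real" where
  "induced_weight w n X = Min (weight w n ` X)"

text \<open>A code with fewer than two elements has no minimum distance.\<close>

definition has_min_distance ::
  "('a::ab_group_add \<Rightarrow> real) \<Rightarrow> nat \<Rightarrow> (nat \<Rightarrow> 'a) set set \<Rightarrow> real \<Rightarrow> bool" where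
  "has_min_distance w n C d \<longleftrightarrow>
     (\<exists>x\<in>C. \<exists>y\<in>C. x \<noteq> y)
     \<and> d = Min {induced_weight w n (coset_diff x y) | x y. x \<in> C \<and> y \<in> C \<and> x \<noteq> y}"

definition quotient_code ::
  "('r \<Rightarrow> 'a::ab_group_add \<Rightarrow> 'a) \<Rightarrow> ('a \<Rightarrow> 'r \<Rightarrow> 'a) \<Rightarrow> ('a \<Rightarrow> real) \<Rightarrow>
     nat \<Rightarrow> nat \<Rightarrow> nat \<Rightarrow> real \<Rightarrow> (nat \<Rightarrow> 'a) set \<Rightarrow> (nat \<Rightarrow> 'a) set set \<Rightarrow> bool" where
  "quotient_code lact ract w n s l d K C \<longleftrightarrow>
     sub_bimodule lact ract n K \<and> card (supp n K) = l
     \<and> C \<subseteq> quotient_words n K \<and> has_min_distance w n C d \<and> card (supp n (\<Union>C)) = s"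

text \<open>The supremum is a maximum when such a code exists, and 0 otherwise.\<close>

definition max_code_size ::
  "('r \<Rightarrow> 'a::ab_group_add \<Rightarrow> 'a) \<Rightarrow> ('a \<Rightarrow> 'r \<Rightarrow> 'a) \<Rightarrow> ('a \<Rightarrow> real) \<Rightarrow>
     nat \<Rightarrow> nat \<Rightarrow> nat \<Rightarrow> real \<Rightarrow> nat" where
  "max_code_size lact ract w n s l d = Sup {card C | K C. quotient_code lact ract w n s l d K C}"

definition min_distances ::
  "('r \<Rightarrow> 'a::ab_group_add \<Rightarrow> 'a) \<Rightarrow> ('a \<Rightarrow> 'r \<Rightarrow> 'a) \<Rightarrow> ('a \<Rightarrow> real) \<Rightarrow>
     nat \<Rightarrow> nat \<Rightarrow> nat \<Rightarrow> real set" where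
  "min_distances lact ract w n s l = {d. \<exists>K C. quotient_code lact ract w n s l d K C}"

text \<open>
  Minimum distances take only finitely many values for given n, s, l. A real number d is rounded
  up to the next such value; d is left unchanged if it is itself attained, or if no value above
  it is attained (there is then no code with minimum distance d).
\<close>

definition distance_ceiling ::
  "('r \<Rightarrow> 'a::ab_group_add \<Rightarrow> 'a) \<Rightarrow> ('a \<Rightarrow> 'r \<Rightarrow> 'a) \<Rightarrow> ('a \<Rightarrow> real) \<Rightarrow>
     nat \<Rightarrow> nat \<Rightarrow> nat \<Rightarrow> real \<Rightarrow> real" where
  "distance_ceiling lact ract w n s l d =
     (let D = {e \<in> min_distances lact ract w n s l. d \<le> e} in if D = {} then d else Min D)"

definition log_size :: "nat \<Rightarrow> nat \<Rightarrow> ereal" where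
  "log_size q m = (if m = 0 then -\<infinity> else ereal (log (real q) (real m)))"

text \<open>
  The products of n with the three real parameters are rounded to admissible values: to the
  integer part for the support sizes, and up to the next attained minimum distance. Where the
  products are themselves admissible, nothing is rounded.
\<close>

definition alpha ::
  "('r \<Rightarrow> 'a::{finite,ab_group_add} \<Rightarrow> 'a) \<Rightarrow> ('a \<Rightarrow> 'r \<Rightarrow> 'a) \<Rightarrow> ('a \<Rightarrow> real) \<Rightarrow>
     real \<Rightarrow> real \<Rightarrow> real \<Rightarrow> ereal" where
  "alpha lact ract w \<sigma> lam \<delta> =
     limsup (\<lambda>n. let s = nat \<lfloor>\<sigma> * real n\<rfloor>; l = nat \<lfloor>lam * real n\<rfloor>;
                     d = distance_ceiling lact ract w n s l (\<delta> * real n)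
                 in ereal (1 / real n) *
                    log_size (card (UNIV :: 'a set)) (max_code_size lact ract w n s l d))"

end

theory Submission
  imports Defs "HOL-Library.FuncSet" "HOL-Real_Asymp.Real_Asymp"
begin

text \<open>
  A Frobenius bimodule carries a character \<chi> whose kernel contains no nonzero left submodule, and
  averaging \<gamma> (1 - \<chi>(u x)) over the units u gives the homogeneous weight, by uniqueness of the
  latter. The one delicate point is that this average depends only on Rx: two generators of a
  cyclic module over a finite ring differ by a unit, because the number of u in a given left ideal
  with u y = z is the same for all generators z of Ry, hence (induction over left ideals) so is
  the number of such u that generate the whole ring. Now \<gamma> - w is an average of positive definite
  functions, so the pairwise distances in a set of M words supported on s coordinates sum up to at
  most \<gamma> s M^2. This is the Plotkin bound; it applies to coset codes since any choice of
  representatives has distances at least the induced ones. Fixing the letters on all but t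
  coordinates, with \<gamma> t just below the distance, yields the exponent \<sigma> - \<delta>/\<gamma>.
\<close>

section \<open>Left ideals, units and cyclic submodules over a finite ring\<close>

context bimodule
begin

abbreviation cyclic :: "'a \<Rightarrow> 'a set" where
  "cyclic x \<equiv> range (\<lambda>r. lact r x)"

lemma lact_zero_right [simp]: "lact r 0 = 0"
  using lact_add_right[of r 0 0] by simp

lemma lact_zero_left [simp]: "lact 0 x = 0"
  using lact_add_left[of 0 0 x] by simp

lemma lact_minus_left: "lact (- r) x = - lact r x"
  using lact_add_left[of r "- r" x] by (metis add.right_inverse lact_zero_left minus_unique)

lemma lact_minus_right: "lact r (- x) = - lact r x"
  using lact_add_right[of r x "- x"] by (metis add.right_inverse lact_zero_right minus_unique)

lemma lact_diff_left: "lact (r - s) x = lact r x - lact s x"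
  using lact_add_left[of r "- s" x] by (simp add: lact_minus_left)

lemma lact_diff_right: "lact r (x - y) = lact r x - lact r y"
  using lact_add_right[of r x "- y"] by (simp add: lact_minus_right)

lemma self_in_cyclic: "x \<in> cyclic x"
  by (metis lact_one rangeI)

lemma cyclic_subset_iff: "cyclic x \<subseteq> cyclic y \<longleftrightarrow> x \<in> cyclic y"
proof
  assume "x \<in> cyclic y"
  then obtain s where "x = lact s y" by auto
  then show "cyclic x \<subseteq> cyclic y" by (auto simp flip: lact_mult)
qed (use self_in_cyclic in blast)

text \<open>The set counted is empty or a coset of the elements of the left ideal that annihilate y,
  and it is empty for both or for neither of two generators of the same cyclic module.\<close>

lemma card_solutions_in_left_ideal:
  fixes u0 :: 'r
  assumes "cyclic z = cyclic y"
  defines "L \<equiv> range (\<lambda>r. r * u0)"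
  shows "card {u \<in> L. lact u y = z} = card {u \<in> L. lact u y = y}"
proof -
  have diff: "u - v \<in> L" and add: "u + v \<in> L" if "u \<in> L" "v \<in> L" for u v
    using that unfolding L_def by (auto simp flip: left_diff_distrib distrib_right)
  have solvable: "\<exists>u\<in>L. lact u y = z'"
    if u: "u \<in> L" "lact u y = z''" and z': "z' \<in> cyclic z''" for u z' z''
  proof -
    obtain r where r: "z' = lact r z''" using z' by auto
    have "r * u \<in> L" using u(1) unfolding L_def by (auto simp flip: mult.assoc)
    then show ?thesis using r u(2) by (metis lact_mult)
  qed
  have translate: "card {u \<in> L. lact u y = z'} = card {u \<in> L. lact u y = 0}"
    if "v \<in> L" "lact v y = z'" for v z'
    by (rule bij_betw_same_card[of "\<lambda>u. u - v"], rule bij_betwI[where g = "\<lambda>u. u + v"])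
      (use that diff add in \<open>auto simp: lact_diff_left lact_add_left\<close>)
  show ?thesis
  proof (cases "\<exists>u\<in>L. lact u y = z")
    case True
    then obtain u where u: "u \<in> L" "lact u y = z" by auto
    have "y \<in> cyclic z" using assms self_in_cyclic by auto
    from solvable[OF u this] obtain v where "v \<in> L" "lact v y = y" by auto
    then show ?thesis using translate u by metis
  next
    case False
    have "z \<in> cyclic y" using assms self_in_cyclic by auto
    with False solvable have "\<not> (\<exists>u\<in>L. lact u y = y)" by blast
    with False have "{u \<in> L. lact u y = z} = {}" "{u \<in> L. lact u y = y} = {}" by auto
    then show ?thesis by (simp only:)
  qed
qed

text \<open>Induction over left ideals: the solutions inside \<open>L\<close> are sorted by the left
  ideal that they generate. The totals agree for \<open>z\<close> and \<open>y\<close>, and so do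
  the contributions of smaller ideals, hence also the solutions generating \<open>L\<close> itself.
  The case \<open>L = UNIV\<close> counts units.\<close>

lemma card_solutions_generating:
  fixes L :: "'r set"
  assumes "cyclic z = cyclic y"
  shows "card {u. lact u y = z \<and> range (\<lambda>r. r * u) = L}
       = card {u. lact u y = y \<and> range (\<lambda>r. r * u) = L}"
proof (induction "card L" arbitrary: L rule: less_induct)
  case less
  let ?I = "\<lambda>u::'r. range (\<lambda>r. r * u)"
  let ?N = "\<lambda>z L. {u. lact u y = z \<and> ?I u = L}"
  show ?case
  proof (cases "\<exists>u0. ?I u0 = L")
    case False
    then have "?N z L = {}" "?N y L = {}" by auto
    then show ?thesis by (simp only:)
  next
    case True
    then obtain u0 where u0: "L = ?I u0" by auto
    have mem: "u \<in> L \<longleftrightarrow> ?I u \<subseteq> L" for u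
    proof
      assume "u \<in> L"
      then show "?I u \<subseteq> L" unfolding u0 by (auto simp flip: mult.assoc)
    next
      assume "?I u \<subseteq> L"
      moreover have "1 * u \<in> ?I u" by blast
      ultimately show "u \<in> L" by auto
    qed
    \<comment> \<open>\<open>L'\<close> runs over all proper subsets of \<open>L\<close>; those that
      are not principal left ideals contribute the empty set.\<close>
    have split: "card {u \<in> L. lact u y = z'} = card (?N z' L) + (\<Sum>L'\<in>{L'. L' \<subset> L}. card (?N z' L'))"
      for z'
    proof -
      have "{u \<in> L. lact u y = z'} = ?N z' L \<union> (\<Union>L'\<in>{L'. L' \<subset> L}. ?N z' L')"
        using mem by blast
      also have "card \<dots> = card (?N z' L) + card (\<Union>L'\<in>{L'. L' \<subset> L}. ?N z' L')"
        by (rule card_Un_disjoint) auto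
      also have "card (\<Union>L'\<in>{L'. L' \<subset> L}. ?N z' L') = (\<Sum>L'\<in>{L'. L' \<subset> L}. card (?N z' L'))"
        by (rule card_UN_disjoint) auto
      finally show ?thesis .
    qed
    have "(\<Sum>L'\<in>{L'. L' \<subset> L}. card (?N z L')) = (\<Sum>L'\<in>{L'. L' \<subset> L}. card (?N y L'))"
      by (rule sum.cong) (use less in \<open>auto simp: psubset_card_mono\<close>)
    with split[of z] split[of y] card_solutions_in_left_ideal[OF assms, of u0] u0
    show ?thesis by simp
  qed
qed

text \<open>In a finite ring a left-invertible element is invertible, so this is the unit
  group.\<close>

definition lunits :: "'r set" where
  "lunits = {u. \<exists>v. v * u = 1}"

lemma one_in_lunits: "1 \<in> lunits"
  unfolding lunits_def by (auto intro: exI[of _ 1])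

lemma lunits_mult: "u \<in> lunits \<Longrightarrow> v \<in> lunits \<Longrightarrow> u * v \<in> lunits"
  unfolding lunits_def by (clarsimp, metis mult.assoc mult_1_left)

lemma lunits_iff: "u \<in> lunits \<longleftrightarrow> range (\<lambda>r. r * u) = UNIV"
proof
  assume "u \<in> lunits"
  then obtain v where "v * u = 1" unfolding lunits_def by auto
  then have "r = (r * v) * u" for r by (simp add: mult.assoc)
  then show "range (\<lambda>r. r * u) = UNIV" by (metis surjI)
next
  assume "range (\<lambda>r. r * u) = UNIV"
  then have "1 \<in> range (\<lambda>r. r * u)" by simp
  then obtain v where "1 = v * u" by auto
  then show "u \<in> lunits" unfolding lunits_def by auto
qed

text \<open>Right multiplication by \<open>u\<close> is onto the ring, hence injective by
  finiteness. This justifies substitutions in averages over \<open>lunits\<close>.\<close>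

lemma bij_betw_lunits_mult:
  assumes "u \<in> lunits"
  shows "bij_betw (\<lambda>v. v * u) lunits lunits"
proof -
  have "inj (\<lambda>v. v * u)"
    using assms by (simp add: lunits_iff finite_UNIV_surj_inj)
  then have "inj_on (\<lambda>v. v * u) lunits" using inj_on_subset by blast
  moreover have "(\<lambda>v. v * u) ` lunits \<subseteq> lunits" using assms lunits_mult by auto
  ultimately show ?thesis
    by (simp add: bij_betw_def endo_inj_surj)
qed

text \<open>The number of units taking \<open>y\<close> to \<open>x\<close> equals the number fixing
  \<open>y\<close>, which is positive because 1 is one of them.\<close>

lemma same_cyclic_imp_unit_multiple:
  assumes "cyclic x = cyclic y"
  shows "\<exists>u\<in>lunits. lact u y = x"
proof -
  have "1 \<in> {u. lact u y = y \<and> range (\<lambda>r. r * u) = UNIV}" by (simp add: lact_one)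
  then have "card {u. lact u y = y \<and> range (\<lambda>r. r * u) = UNIV} > 0"
    by (metis card_gt_0_iff empty_iff finite)
  then have "card {u. lact u y = x \<and> range (\<lambda>r. r * u) = UNIV} > 0"
    using card_solutions_generating[OF assms, of UNIV] by simp
  then have "{u. lact u y = x \<and> range (\<lambda>r. r * u) = UNIV} \<noteq> {}"
    unfolding card_gt_0_iff by blast
  then show ?thesis by (auto simp: lunits_iff)
qed

text \<open>Induction on the size of \<open>cyclic x\<close>: a homogeneous weight is constant on
  the generators of \<open>cyclic x\<close>, and all other elements generate smaller modules. The
  averaging equation then determines the common value on the generators.\<close>

lemma homogeneous_weight_unique:
  assumes "homogeneous_weight lact v \<gamma>" "homogeneous_weight lact w \<gamma>"
  shows "v x = w x"
proof (induction "card (cyclic x)" arbitrary: x rule: less_induct)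
  case less
  show ?case
  proof (cases "x = 0")
    case True
    then show ?thesis using assms unfolding homogeneous_weight_def by simp
  next
    case False
    let ?G = "{y. cyclic y = cyclic x}"
    have G: "?G \<subseteq> cyclic x" using self_in_cyclic by blast
    have split: "\<gamma> * real (card (cyclic x)) = real (card ?G) * h x + sum h (cyclic x - ?G)"
      if h: "homogeneous_weight lact h \<gamma>" for h
    proof -
      have "\<gamma> * real (card (cyclic x)) = sum h (cyclic x)"
        using h False unfolding homogeneous_weight_def by metis
      also have "\<dots> = sum h ?G + sum h (cyclic x - ?G)"
        using sum.subset_diff[OF G] by (simp add: add.commute)
      also have "sum h ?G = (\<Sum>y\<in>?G. h x)"
        by (rule sum.cong) (use h in \<open>unfold homogeneous_weight_def, blast+\<close>)
      finally show ?thesis by simp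
    qed
    have "sum v (cyclic x - ?G) = sum w (cyclic x - ?G)"
    proof (rule sum.cong)
      fix y assume y: "y \<in> cyclic x - ?G"
      then have "cyclic y \<subset> cyclic x" using cyclic_subset_iff[of y x] by blast
      then show "v y = w y" by (intro less psubset_card_mono) auto
    qed simp
    moreover have "card ?G > 0" by (subst card_gt_0_iff) auto
    moreover have "real (card ?G) * v x + sum v (cyclic x - ?G)
        = real (card ?G) * w x + sum w (cyclic x - ?G)"
      using split[OF assms(1)] split[OF assms(2)] by (simp only:)
    ultimately show ?thesis by auto
  qed
qed

end

section \<open>Characters and the formula for the homogeneous weight\<close>

lemma additive_character_zero:
  fixes \<chi> :: "'a::group_add \<Rightarrow> complex"
  assumes "\<And>x. \<chi> x \<noteq> 0" "\<And>x y. \<chi> (x + y) = \<chi> x * \<chi> y"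
  shows "\<chi> 0 = 1"
  using assms(2)[of 0 0] assms(1)[of 0] by simp

text \<open>Translating the sum of all moduli by \<open>x\<close> multiplies it by
  \<open>cmod (\<chi> x)\<close>. The sum is positive and finite, so this modulus is 1.\<close>

lemma additive_character_cnj:
  fixes \<chi> :: "'a::{finite,ab_group_add} \<Rightarrow> complex"
  assumes nz: "\<And>x. \<chi> x \<noteq> 0" and add: "\<And>x y. \<chi> (x + y) = \<chi> x * \<chi> y"
  shows "\<chi> (- x) = cnj (\<chi> x)"
proof -
  have "(\<Sum>y\<in>UNIV. cmod (\<chi> y)) = (\<Sum>y\<in>UNIV. cmod (\<chi> (x + y)))"
    by (rule sum.reindex_bij_witness[of _ "\<lambda>y. x + y" "\<lambda>y. y - x"]) auto
  also have "\<dots> = cmod (\<chi> x) * (\<Sum>y\<in>UNIV. cmod (\<chi> y))"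
    by (simp add: add norm_mult sum_distrib_left)
  finally have "cmod (\<chi> x) = 1 \<or> (\<Sum>y\<in>UNIV. cmod (\<chi> y)) = 0" by auto
  moreover have "(\<Sum>y\<in>UNIV. cmod (\<chi> y)) > 0" using nz by (intro sum_pos) auto
  ultimately have "\<chi> x * cnj (\<chi> x) = 1"
    by (simp add: complex_norm_square[symmetric])
  moreover have "\<chi> x * \<chi> (- x) = 1"
    using add[of x "- x"] additive_character_zero[of \<chi>] nz add by simp
  ultimately show ?thesis using nz[of x] by (metis mult_left_cancel)
qed

context frobenius_bimodule
begin

text \<open>The character is evaluation at 1 of the isomorphism \<open>f\<close> with the character
  module. As \<open>f (lact r x)\<close> at 1 equals \<open>f x\<close> at \<open>r\<close>,
  triviality on all of \<open>cyclic x\<close> makes \<open>f x\<close> trivial, and injectivity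
  gives \<open>x = 0\<close>.\<close>

lemma generating_character:
  obtains \<chi> :: "'a \<Rightarrow> complex"
  where "\<And>x. \<chi> x \<noteq> 0" "\<And>x y. \<chi> (x + y) = \<chi> x * \<chi> y"
    "\<And>x. (\<And>r. \<chi> (lact r x) = 1) \<Longrightarrow> x = 0"
proof -
  obtain f where f: "bij_betw f UNIV (characters :: ('r \<Rightarrow> complex) set)"
    and add: "\<And>a b. f (a + b) = (\<lambda>x. f a x * f b x)"
    and act: "\<And>r a. f (lact r a) = char_lact r (f a)"
    using left_iso by blast
  have nz: "f a r \<noteq> 0" for a r
    using bij_betwE[OF f] unfolding characters_def by blast
  have f0: "f 0 = (\<lambda>r. 1)"
    using add[of 0 0] nz[of 0] by (auto simp: fun_eq_iff)
  have inj: "inj f" using f bij_betw_def by blast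
  show thesis
  proof (rule that[of "\<lambda>x. f x 1"])
    fix x assume "\<And>r. f (lact r x) 1 = 1"
    then have "f x = f 0" by (simp add: act char_lact_def f0 fun_eq_iff)
    then show "x = 0" using inj by (simp add: inj_eq)
  qed (use nz add in auto)
qed

text \<open>Generators of the same cyclic module differ by a unit, which the average over
  \<open>lunits\<close> absorbs. On a nonzero cyclic module every unit acts as a permutation and
  \<open>\<chi>\<close> is nontrivial, so the character sums vanish and only the constant \<gamma>
  survives.\<close>

lemma homogeneous_weight_character_average:
  fixes \<chi> :: "'a \<Rightarrow> complex"
  assumes nz: "\<And>x. \<chi> x \<noteq> 0" and add: "\<And>x y. \<chi> (x + y) = \<chi> x * \<chi> y"
    and gen: "\<And>x. (\<And>r. \<chi> (lact r x) = 1) \<Longrightarrow> x = 0"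
  shows "homogeneous_weight lact
    (\<lambda>x. \<gamma> * (1 - (\<Sum>u\<in>lunits. Re (\<chi> (lact u x))) / real (card lunits))) \<gamma>"
  unfolding homogeneous_weight_def
proof (intro conjI allI impI)
  have pos: "card lunits > 0"
    using one_in_lunits by (auto simp: card_gt_0_iff)
  have \<chi>0: "\<chi> 0 = 1" using additive_character_zero nz add by blast
  show "\<gamma> * (1 - (\<Sum>u\<in>lunits. Re (\<chi> (lact u 0))) / real (card lunits)) = 0"
    using pos by (auto simp: \<chi>0)
  fix x y :: 'a
  {
    assume "cyclic x = cyclic y"
    then obtain u0 where u0: "u0 \<in> lunits" "x = lact u0 y"
      using same_cyclic_imp_unit_multiple by blast
    have "(\<Sum>u\<in>lunits. Re (\<chi> (lact u x))) = (\<Sum>u\<in>lunits. Re (\<chi> (lact (u * u0) y)))"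
      using u0 by (simp add: lact_mult)
    also have "\<dots> = (\<Sum>u\<in>lunits. Re (\<chi> (lact u y)))"
      by (rule sum.reindex_bij_betw[OF bij_betw_lunits_mult[OF u0(1)]])
    finally show "\<gamma> * (1 - (\<Sum>u\<in>lunits. Re (\<chi> (lact u x))) / real (card lunits))
      = \<gamma> * (1 - (\<Sum>u\<in>lunits. Re (\<chi> (lact u y))) / real (card lunits))" by simp
  }
  assume "x \<noteq> 0"
  have zero: "(\<Sum>y\<in>cyclic x. \<chi> (lact u y)) = 0" if u: "u \<in> lunits" for u
  proof -
    obtain v where v: "v * u = 1" using u unfolding lunits_def by auto
    have inj: "inj_on (lact u) (cyclic x)"
      by (rule inj_on_inverseI[of _ "lact v"]) (simp add: v lact_one flip: lact_mult)
    have "lact u ` cyclic x \<subseteq> cyclic x" by (auto simp flip: lact_mult)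
    with inj have "bij_betw (lact u) (cyclic x) (cyclic x)"
      by (simp add: bij_betw_def endo_inj_surj)
    then have eq: "(\<Sum>y\<in>cyclic x. \<chi> (lact u y)) = sum \<chi> (cyclic x)"
      by (rule sum.reindex_bij_betw)
    obtain r where r: "\<chi> (lact r x) \<noteq> 1" using gen \<open>x \<noteq> 0\<close> by blast
    \<comment> \<open>Translation by \<open>lact r x\<close> permutes \<open>cyclic x\<close>, so
      the sum is unchanged by a factor other than 1 and must be zero.\<close>
    have "sum \<chi> (cyclic x) = (\<Sum>y\<in>cyclic x. \<chi> (lact r x + y))"
      by (rule sum.reindex_bij_witness[of _ "\<lambda>y. lact r x + y" "\<lambda>y. y - lact r x"])
        (auto simp flip: lact_add_left lact_diff_left)
    also have "\<dots> = \<chi> (lact r x) * sum \<chi> (cyclic x)"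
      by (simp add: add sum_distrib_left)
    finally show ?thesis using r eq by simp
  qed
  have "(\<Sum>y\<in>cyclic x. \<Sum>u\<in>lunits. Re (\<chi> (lact u y)))
      = (\<Sum>u\<in>lunits. Re (\<Sum>y\<in>cyclic x. \<chi> (lact u y)))"
    by (subst sum.swap) simp
  also have "\<dots> = 0" using zero by (simp del: Re_sum)
  finally show "(\<Sum>y\<in>cyclic x. \<gamma> * (1 - (\<Sum>u\<in>lunits. Re (\<chi> (lact u y))) / real (card lunits)))
      = \<gamma> * real (card (cyclic x))"
    by (simp add: sum_subtractf flip: sum_distrib_left sum_divide_distrib)
qed

section \<open>Plotkin bounds for sets of words\<close>

lemma sum_homogeneous_weight_differences_le:
  assumes "homogeneous_weight lact w \<gamma>" "\<gamma> \<ge> 0" "finite X"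
  shows "(\<Sum>x\<in>X. \<Sum>y\<in>X. w (a x - a y)) \<le> \<gamma> * (real (card X))\<^sup>2"
proof -
  obtain \<chi> :: "'a \<Rightarrow> complex" where nz: "\<And>x. \<chi> x \<noteq> 0"
    and add: "\<And>x y. \<chi> (x + y) = \<chi> x * \<chi> y"
    and gen: "\<And>x. (\<And>r. \<chi> (lact r x) = 1) \<Longrightarrow> x = 0"
    using generating_character by metis
  have w: "w x = \<gamma> * (1 - (\<Sum>u\<in>lunits. Re (\<chi> (lact u x))) / real (card lunits))" for x
    using homogeneous_weight_unique[OF assms(1)
        homogeneous_weight_character_average[OF nz add gen]] .
  \<comment> \<open>Positive definiteness: the double sum is the squared modulus of a single
    character sum.\<close>
  have nonneg: "0 \<le> (\<Sum>x\<in>X. \<Sum>y\<in>X. Re (\<chi> (lact u (a x - a y))))" for u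
  proof -
    let ?S = "\<Sum>x\<in>X. \<chi> (lact u (a x))"
    have "\<chi> (lact u (a x - a y)) = \<chi> (lact u (a x)) * cnj (\<chi> (lact u (a y)))" for x y
      using add[of "lact u (a x)" "- lact u (a y)"] additive_character_cnj[of \<chi>] nz add
      by (simp add: lact_diff_right)
    then have "(\<Sum>x\<in>X. \<Sum>y\<in>X. Re (\<chi> (lact u (a x - a y)))) = Re (?S * cnj ?S)"
      by (simp only: cnj_sum sum_product Re_sum)
    also have "\<dots> = (cmod ?S)\<^sup>2" by (metis Re_complex_of_real complex_norm_square)
    also have "\<dots> \<ge> 0" by simp
    finally show ?thesis .
  qed
  have "(\<Sum>x\<in>X. \<Sum>y\<in>X. w (a x - a y))
      = \<gamma> * ((real (card X))\<^sup>2
          - (\<Sum>x\<in>X. \<Sum>y\<in>X. \<Sum>u\<in>lunits. Re (\<chi> (lact u (a x - a y)))) / real (card lunits))"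
    by (simp add: w sum_subtractf power2_eq_square flip: sum_distrib_left sum_divide_distrib)
  also have "(\<Sum>x\<in>X. \<Sum>y\<in>X. \<Sum>u\<in>lunits. Re (\<chi> (lact u (a x - a y))))
      = (\<Sum>u\<in>lunits. \<Sum>x\<in>X. \<Sum>y\<in>X. Re (\<chi> (lact u (a x - a y))))"
    by (simp add: sum.swap[of _ lunits])
  also have "\<gamma> * ((real (card X))\<^sup>2 - \<dots> / real (card lunits)) \<le> \<gamma> * (real (card X))\<^sup>2"
  proof (rule mult_left_mono)
    have "0 \<le> (\<Sum>u\<in>lunits. \<Sum>x\<in>X. \<Sum>y\<in>X. Re (\<chi> (lact u (a x - a y))))"
      by (rule sum_nonneg) (rule nonneg)
    then show "(real (card X))\<^sup>2
        - (\<Sum>u\<in>lunits. \<Sum>x\<in>X. \<Sum>y\<in>X. Re (\<chi> (lact u (a x - a y)))) / real (card lunits)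
        \<le> (real (card X))\<^sup>2" by simp
  qed fact
  finally show ?thesis .
qed

text \<open>The distances over ordered pairs of distinct words are counted twice: pair by pair each
  is at least \<open>D\<close>, while each coordinate in \<open>T\<close> contributes at most
  \<gamma> times the square of \<open>card X\<close>.\<close>

lemma plotkin_bound:
  fixes X :: "(nat \<Rightarrow> 'a) set"
  assumes w: "homogeneous_weight lact w \<gamma>" "\<gamma> \<ge> 0" and fin: "finite X"
    and dist: "\<And>x y. x \<in> X \<Longrightarrow> y \<in> X \<Longrightarrow> x \<noteq> y \<Longrightarrow> D \<le> (\<Sum>i\<in>T. w (x i - y i))"
    and D: "\<gamma> * real (card T) < D"
  shows "real (card X) \<le> D / (D - \<gamma> * real (card T))"
proof (cases "X = {}")
  case True
  have "0 \<le> \<gamma> * real (card T)" using w by simp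
  then show ?thesis using True D by simp
next
  case False
  let ?M = "real (card X)"
  have M: "?M > 0" using False fin by (simp add: card_gt_0_iff)
  have w0: "w 0 = 0" using w unfolding homogeneous_weight_def by simp
  have "?M * ((?M - 1) * D) = (\<Sum>x\<in>X. \<Sum>y\<in>X - {x}. D)"
    using fin False by (simp add: card_Diff_singleton of_nat_diff Suc_leI card_gt_0_iff)
  also have "\<dots> \<le> (\<Sum>x\<in>X. \<Sum>y\<in>X - {x}. \<Sum>i\<in>T. w (x i - y i))"
    by (intro sum_mono dist) auto
  \<comment> \<open>The diagonal is added at no cost since \<open>w 0 = 0\<close>; the
    coordinatewise estimate needs the full square.\<close>
  also have "\<dots> = (\<Sum>x\<in>X. \<Sum>y\<in>X. \<Sum>i\<in>T. w (x i - y i))"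
    by (intro sum.cong refl sum.mono_neutral_left) (use fin w0 in auto)
  also have "\<dots> = (\<Sum>i\<in>T. \<Sum>x\<in>X. \<Sum>y\<in>X. w (x i - y i))"
    by (simp add: sum.swap[of _ T])
  also have "\<dots> \<le> (\<Sum>i\<in>T. \<gamma> * ?M\<^sup>2)"
    by (intro sum_mono sum_homogeneous_weight_differences_le w fin)
  finally have "?M * ((?M - 1) * D) \<le> ?M * (\<gamma> * real (card T) * ?M)"
    by (simp add: power2_eq_square algebra_simps)
  then have "(?M - 1) * D \<le> \<gamma> * real (card T) * ?M" using M by simp
  then have "?M * (D - \<gamma> * real (card T)) \<le> D" by (simp add: algebra_simps)
  then show ?thesis using D by (simp add: field_simps)
qed

text \<open>Words with the same letters on \<open>S - T\<close> differ only on \<open>T\<close>,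
  where the previous bound applies. The power of the alphabet size counts the possible patterns on
  \<open>S - T\<close>.\<close>

lemma shortened_plotkin_bound:
  fixes X :: "(nat \<Rightarrow> 'a) set"
  assumes w: "homogeneous_weight lact w \<gamma>" "\<gamma> \<ge> 0" and fin: "finite X" "finite S" "T \<subseteq> S"
    and dist: "\<And>x y. x \<in> X \<Longrightarrow> y \<in> X \<Longrightarrow> x \<noteq> y \<Longrightarrow> D \<le> (\<Sum>i\<in>S. w (x i - y i))"
    and D: "\<gamma> * real (card T) < D"
  shows "real (card X)
    \<le> real (card (UNIV :: 'a set)) ^ (card S - card T) * (D / (D - \<gamma> * real (card T)))"
proof -
  let ?P = "S - T \<rightarrow>\<^sub>E (UNIV :: 'a set)" and ?B = "D / (D - \<gamma> * real (card T))"
  have w0: "w 0 = 0" using w unfolding homogeneous_weight_def by simp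
  have finP: "finite ?P" using fin by (intro finite_PiE) auto
  have fibre: "real (card {x \<in> X. restrict x (S - T) = p}) \<le> ?B" for p
  proof (rule plotkin_bound[OF w _ _ D])
    fix x y assume x: "x \<in> {x \<in> X. restrict x (S - T) = p}"
      and y: "y \<in> {x \<in> X. restrict x (S - T) = p}" and "x \<noteq> y"
    have "x i = y i" if "i \<in> S - T" for i
      using x y that by (metis (mono_tags, lifting) mem_Collect_eq restrict_apply')
    then have "(\<Sum>i\<in>S. w (x i - y i)) = (\<Sum>i\<in>T. w (x i - y i))"
      by (intro sum.mono_neutral_right) (use fin w0 in auto)
    then show "D \<le> (\<Sum>i\<in>T. w (x i - y i))" using dist[of x y] x y \<open>x \<noteq> y\<close> by simp
  qed (use fin in simp)
  have "card X = (\<Sum>p\<in>?P. card {x \<in> X. restrict x (S - T) = p})"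
    using sum.group[of X ?P "\<lambda>x. restrict x (S - T)" "\<lambda>x. 1::nat"] fin finP
    by (simp add: image_subset_iff)
  then have "real (card X) = (\<Sum>p\<in>?P. real (card {x \<in> X. restrict x (S - T) = p}))" by simp
  also have "\<dots> \<le> (\<Sum>p\<in>?P. ?B)" by (intro sum_mono fibre)
  also have "\<dots> = real (card ?P) * ?B" by simp
  also have "card ?P = card (UNIV :: 'a set) ^ (card S - card T)"
    using fin by (simp add: card_PiE card_Diff_subset finite_subset)
  finally show ?thesis by simp
qed

end

section \<open>Quotient codes: finiteness and choice of representatives\<close>

lemma finite_words: "finite (words n :: (nat \<Rightarrow> 'a::{finite,zero}) set)"
proof -
  have "finite {f :: nat \<Rightarrow> 'a. \<forall>i. (i \<in> {..<n} \<longrightarrow> f i \<in> UNIV) \<and> (i \<notin> {..<n} \<longrightarrow> f i = 0)}"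
    by (rule finite_set_of_finite_funs) auto
  then show ?thesis unfolding words_def by (rule rev_finite_subset) auto
qed

lemma quotient_word_subset_words:
  assumes "sub_bimodule lact ract n K" "X \<in> quotient_words n K"
  shows "X \<subseteq> words n"
  using assms unfolding sub_bimodule_def quotient_words_def coset_def words_def by fastforce

lemma quotient_word_nonempty:
  assumes "sub_bimodule lact ract n K" "X \<in> quotient_words n K"
  shows "X \<noteq> {}"
  using assms unfolding sub_bimodule_def quotient_words_def coset_def by auto

lemma coset_diff_subset_words:
  assumes "X \<subseteq> words n" "Y \<subseteq> words n"
  shows "coset_diff X Y \<subseteq> words n"
  using assms unfolding coset_diff_def words_def by fastforce

lemma finite_distances:
  fixes C :: "'b set"
  assumes "finite C"
  shows "finite {h x y | x y. x \<in> C \<and> y \<in> C \<and> x \<noteq> y}"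
  by (rule finite_subset[of _ "(\<lambda>(x, y). h x y) ` (C \<times> C)"]) (use assms in auto)

lemma finite_quotient_code:
  fixes C :: "(nat \<Rightarrow> 'a::{finite,ab_group_add}) set set"
  assumes "quotient_code lact ract w n s l d K C"
  shows "finite C"
  using assms finite_words[where 'a = 'a]
  unfolding quotient_code_def quotient_words_def by (meson finite_imageI finite_subset)

text \<open>Both minima in the definition are attained, so each minimum distance is the weight of
  one of finitely many words. This makes the \<open>Min\<close> in \<open>distance_ceiling\<close>
  meaningful.\<close>

lemma finite_min_distances:
  fixes lact :: "'r \<Rightarrow> 'a::{finite,ab_group_add} \<Rightarrow> 'a"
  shows "finite (min_distances lact ract w n s l)"
proof (rule finite_subset)
  show "finite (weight w n ` words n)" by (intro finite_imageI finite_words)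
  show "min_distances lact ract w n s l \<subseteq> weight w n ` words n"
  proof
    fix d assume "d \<in> min_distances lact ract w n s l"
    then obtain K C where code: "quotient_code lact ract w n s l d K C"
      unfolding min_distances_def by auto
    let ?E = "{induced_weight w n (coset_diff x y) | x y. x \<in> C \<and> y \<in> C \<and> x \<noteq> y}"
    have "d = Min ?E" "?E \<noteq> {}"
      using code unfolding quotient_code_def has_min_distance_def by blast+
    moreover have "finite ?E" by (rule finite_distances[OF finite_quotient_code[OF code]])
    ultimately have "d \<in> ?E" using Min_in by blast
    then obtain x y where xy: "x \<in> C" "y \<in> C" "d = induced_weight w n (coset_diff x y)" by auto
    have K: "sub_bimodule lact ract n K" "C \<subseteq> quotient_words n K"
      using code unfolding quotient_code_def by auto
    have sub: "coset_diff x y \<subseteq> words n"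
      using quotient_word_subset_words[OF K(1)] K(2) xy by (intro coset_diff_subset_words) auto
    have "x \<noteq> {}" "y \<noteq> {}" using quotient_word_nonempty[OF K(1)] K(2) xy by auto
    then have "coset_diff x y \<noteq> {}" unfolding coset_diff_def by auto
    then have "d \<in> weight w n ` coset_diff x y"
      unfolding xy(3) induced_weight_def
      using sub finite_words finite_subset by (intro Min_in finite_imageI) blast+
    then show "d \<in> weight w n ` words n" using sub by auto
  qed
qed

lemma distance_ceiling_ge:
  fixes lact :: "'r \<Rightarrow> 'a::{finite,ab_group_add} \<Rightarrow> 'a"
  shows "d \<le> distance_ceiling lact ract w n s l d"
proof -
  have "finite {e \<in> min_distances lact ract w n s l. d \<le> e}"
    using finite_min_distances by (rule rev_finite_subset) auto
  then show ?thesis unfolding distance_ceiling_def Let_def by simp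
qed

text \<open>One word is picked from each coset. A difference of two representatives lies in the
  difference of their cosets, so its weight is at least the induced one; outside the support of the
  union both representatives vanish.\<close>

lemma quotient_code_representatives:
  fixes lact :: "'r \<Rightarrow> 'a::{finite,ab_group_add} \<Rightarrow> 'a"
  assumes code: "quotient_code lact ract w n s l d K C" and w0: "w 0 = 0"
  obtains X where "finite X" "card X = card C"
    "\<And>x y. x \<in> X \<Longrightarrow> y \<in> X \<Longrightarrow> x \<noteq> y \<Longrightarrow> d \<le> (\<Sum>i\<in>supp n (\<Union>C). w (x i - y i))"
proof -
  have K: "sub_bimodule lact ract n K" "C \<subseteq> quotient_words n K"
    and d: "d = Min {induced_weight w n (coset_diff x y) | x y. x \<in> C \<and> y \<in> C \<and> x \<noteq> y}"
    using code unfolding quotient_code_def has_min_distance_def by auto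
  have finC: "finite C" using finite_quotient_code[OF code] .
  have "\<forall>x\<in>C. \<exists>u. x = coset u K" using K(2) unfolding quotient_words_def by blast
  then obtain rep where rep: "\<And>x. x \<in> C \<Longrightarrow> x = coset (rep x) K" by metis
  have rep_in: "rep x \<in> x" if "x \<in> C" for x
  proof -
    have "rep x \<in> coset (rep x) K"
      using K(1) unfolding sub_bimodule_def coset_def by (auto intro!: image_eqI[of _ _ 0])
    then show ?thesis using rep[OF that] by simp
  qed
  have inj: "inj_on rep C" by (rule inj_onI) (metis rep)
  show thesis
  proof (rule that[of "rep ` C"])
    fix u v assume "u \<in> rep ` C" "v \<in> rep ` C" "u \<noteq> v"
    then obtain x y where xy: "x \<in> C" "y \<in> C" "x \<noteq> y" "u = rep x" "v = rep y" by auto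
    have "d \<le> induced_weight w n (coset_diff x y)"
      unfolding d by (rule Min_le[OF finite_distances[OF finC]]) (use xy in blast)
    also have "\<dots> \<le> weight w n (u - v)"
      unfolding induced_weight_def
    proof (rule Min_le)
      have "coset_diff x y \<subseteq> words n"
        using quotient_word_subset_words[OF K(1)] K(2) xy by (intro coset_diff_subset_words) auto
      then show "finite (weight w n ` coset_diff x y)"
        using finite_words finite_subset by blast
      show "weight w n (u - v) \<in> weight w n ` coset_diff x y"
        unfolding coset_diff_def using rep_in xy by blast
    qed
    also have "\<dots> = (\<Sum>i\<in>supp n (\<Union>C). w (u i - v i))"
      unfolding weight_def fun_diff_def
    proof (rule sum.mono_neutral_right)
      show "\<forall>i\<in>{..<n} - supp n (\<Union>C). w (u i - v i) = 0"
      proof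
        fix i assume "i \<in> {..<n} - supp n (\<Union>C)"
        then have "u i = 0" "v i = 0" using rep_in xy unfolding supp_def by auto
        then show "w (u i - v i) = 0" using w0 by simp
      qed
    qed (auto simp: supp_def)
    finally show "d \<le> (\<Sum>i\<in>supp n (\<Union>C). w (u i - v i))" .
  qed (use finC inj card_image in auto)
qed

text \<open>The bound is stated in a lower estimate \<open>D\<close> of the distance, because the
  rounded distance \<open>d\<close> is controlled only from below.\<close>

lemma max_code_size_le:
  fixes lact :: "'r::{finite,ring_1} \<Rightarrow> 'a::{finite,ab_group_add} \<Rightarrow> 'a"
  assumes "frobenius_bimodule lact ract" and w: "homogeneous_weight lact w \<gamma>" "\<gamma> \<ge> 0"
    and "D \<le> d" "t \<le> s" and D: "\<gamma> * real t < D"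
  shows "real (max_code_size lact ract w n s l d)
    \<le> real (card (UNIV :: 'a set)) ^ (s - t) * (D / (D - \<gamma> * real t))" (is "_ \<le> ?B")
proof -
  interpret frobenius_bimodule lact ract by fact
  let ?Q = "{card C | K C. quotient_code lact ract w n s l d K C}"
  have w0: "w 0 = 0" using w unfolding homogeneous_weight_def by simp
  have bound: "real m \<le> ?B" if m: "m \<in> ?Q" for m
  proof -
    obtain K C where code: "quotient_code lact ract w n s l d K C" and m: "m = card C"
      using m by auto
    obtain X where X: "finite X" "card X = card C"
      "\<And>x y. x \<in> X \<Longrightarrow> y \<in> X \<Longrightarrow> x \<noteq> y \<Longrightarrow> d \<le> (\<Sum>i\<in>supp n (\<Union>C). w (x i - y i))"
      using quotient_code_representatives[of lact ract w n s l d K C, OF code w0] by blast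
    have s: "card (supp n (\<Union>C)) = s" using code unfolding quotient_code_def by simp
    then obtain T where T: "T \<subseteq> supp n (\<Union>C)" "card T = t"
      using \<open>t \<le> s\<close> by (metis obtain_subset_with_card_n)
    have "D \<le> (\<Sum>i\<in>supp n (\<Union>C). w (x i - y i))" if "x \<in> X" "y \<in> X" "x \<noteq> y" for x y
      using X(3)[OF that] \<open>D \<le> d\<close> by simp
    moreover have "finite (supp n (\<Union>C))" unfolding supp_def by simp
    moreover have "\<gamma> * real (card T) < D" using D T by simp
    ultimately have "real (card X) \<le> real (card (UNIV :: 'a set)) ^ (card (supp n (\<Union>C)) - card T)
        * (D / (D - \<gamma> * real (card T)))"
      using shortened_plotkin_bound[OF w X(1) _ T(1)] by blast
    then show ?thesis unfolding s T(2) X(2) m .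
  qed
  show ?thesis
  proof (cases "?Q = {}")
    case True
    \<comment> \<open>With no code the supremum of the empty set of naturals is 0, so nonnegativity
      of the bound is enough.\<close>
    have "0 \<le> \<gamma> * real t" using w by simp
    then show ?thesis using True D unfolding max_code_size_def by simp
  next
    case False
    have "Sup ?Q \<le> nat \<lfloor>?B\<rfloor>"
      by (rule cSup_least[OF False]) (use bound in \<open>simp add: le_nat_floor\<close>)
    moreover obtain m where "real m \<le> ?B" using False bound by blast
    then have "?B \<ge> 0" by linarith
    ultimately show ?thesis unfolding max_code_size_def by linarith
  qed
qed

section \<open>Passage to the asymptotic exponent\<close>

lemma log_size_le:
  assumes "q \<ge> 1" "real m \<le> B"
  shows "log_size q m \<le> ereal (log (real q) B)"
proof (cases "q = 1 \<or> m = 0")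
  \<comment> \<open>Either the left side is minus infinity, or the base is 1 and both logarithms are
    0 through division by \<open>ln 1 = 0\<close>.\<close>
  case True
  then show ?thesis by (auto simp: log_size_def log_def)
next
  case False
  then show ?thesis using assms by (simp add: log_size_def)
qed

text \<open>Requiring \<open>B n\<close> for every \<open>d\<close> from
  \<open>\<delta> * real n\<close> upwards disposes of the rounding in \<open>alpha\<close>, since
  \<open>distance_ceiling\<close> never decreases its argument.\<close>

lemma alpha_le:
  fixes lact :: "'r::{finite,ring_1} \<Rightarrow> 'a::{finite,ab_group_add} \<Rightarrow> 'a"
  assumes bound: "\<forall>\<^sub>F n in sequentially. \<forall>d\<ge>\<delta> * real n.
      real (max_code_size lact ract w n (nat \<lfloor>\<sigma> * real n\<rfloor>) (nat \<lfloor>lam * real n\<rfloor>) d) \<le> B n"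
    and log: "\<forall>\<^sub>F n in sequentially. log (real (card (UNIV :: 'a set))) (B n) \<le> b n"
    and lim: "(\<lambda>n. b n / real n) \<longlonglongrightarrow> L"
  shows "alpha lact ract w \<sigma> lam \<delta> \<le> ereal L"
proof -
  have "alpha lact ract w \<sigma> lam \<delta> \<le> limsup (\<lambda>n. ereal (b n / real n))"
    unfolding alpha_def Let_def
  proof (rule Limsup_mono)
    show "\<forall>\<^sub>F n in sequentially. ereal (1 / real n) * log_size (card (UNIV :: 'a set))
        (max_code_size lact ract w n (nat \<lfloor>\<sigma> * real n\<rfloor>) (nat \<lfloor>lam * real n\<rfloor>)
          (distance_ceiling lact ract w n (nat \<lfloor>\<sigma> * real n\<rfloor>) (nat \<lfloor>lam * real n\<rfloor>) (\<delta> * real n)))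
        \<le> ereal (b n / real n)"
      using bound log
    proof eventually_elim
      case (elim n)
      let ?m = "max_code_size lact ract w n (nat \<lfloor>\<sigma> * real n\<rfloor>) (nat \<lfloor>lam * real n\<rfloor>)
          (distance_ceiling lact ract w n (nat \<lfloor>\<sigma> * real n\<rfloor>) (nat \<lfloor>lam * real n\<rfloor>) (\<delta> * real n))"
      have "real ?m \<le> B n" using elim(1) distance_ceiling_ge by blast
      then have "log_size (card (UNIV :: 'a set)) ?m \<le> ereal (log (real (card (UNIV :: 'a set))) (B n))"
        by (intro log_size_le) (auto simp: Suc_le_eq card_gt_0_iff)
      also have "\<dots> \<le> ereal (b n)" using elim(2) by simp
      finally have "ereal (1 / real n) * log_size (card (UNIV :: 'a set)) ?m
          \<le> ereal (1 / real n) * ereal (b n)"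
        by (intro ereal_mult_left_mono) auto
      then show ?case by simp
    qed
  qed
  also have "\<dots> = ereal L"
    using lim by (intro lim_imp_Limsup) auto
  finally show ?thesis .
qed

lemma linear_plus_log_over_n_tendsto:
  fixes c :: real
  assumes "c > 0"
  shows "(\<lambda>n. (\<sigma> * real n - c * real n + 2 + log q (c * real n)) / real n) \<longlonglongrightarrow> \<sigma> - c"
proof (rule Lim_transform_eventually)
  \<comment> \<open>A constant multiple of \<open>ln\<close> covers every base at once; for
    \<open>q = 1\<close> the constant is 0.\<close>
  define k where "k = inverse (ln q)"
  have log: "log q x = k * ln x" for x
    by (simp add: log_def k_def divide_inverse)
  have "(\<lambda>n. ln (c * real n) / real n) \<longlonglongrightarrow> 0"
    using assms by real_asymp
  from tendsto_add[OF tendsto_add[OF tendsto_const lim_const_over_n] tendsto_mult_right_zero[OF this]]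
  show "(\<lambda>n. \<sigma> - c + 2 / real n + k * (ln (c * real n) / real n)) \<longlonglongrightarrow> \<sigma> - c"
    by simp
  show "\<forall>\<^sub>F n in sequentially. \<sigma> - c + 2 / real n + k * (ln (c * real n) / real n)
      = (\<sigma> * real n - c * real n + 2 + log q (c * real n)) / real n"
    using eventually_gt_at_top[of 0]
    by eventually_elim (simp add: log field_simps)
qed

theorem mainTheorem10:
  fixes lact :: "'r::{finite,ring_1} \<Rightarrow> 'a::{finite,ab_group_add} \<Rightarrow> 'a"
    and ract :: "'a \<Rightarrow> 'r \<Rightarrow> 'a"
    and w :: "'a \<Rightarrow> real"
    and \<gamma> \<sigma> lam \<delta> :: real
  assumes "frobenius_bimodule lact ract"
    and "homogeneous_weight lact w \<gamma>"
    and "\<gamma> > 0"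
    and "0 < \<delta>"
    and "0 \<le> lam" and "lam < \<sigma>" and "\<sigma> \<le> 1"
  shows "alpha lact ract w \<sigma> lam \<delta> \<le> (if \<delta> > \<gamma> * \<sigma> then 0 else ereal (\<sigma> - \<delta> / \<gamma>))"
proof -
  let ?q = "real (card (UNIV :: 'a set))"
  have \<sigma>: "\<sigma> > 0" using assms by linarith
  have s_le: "real (nat \<lfloor>\<sigma> * real n\<rfloor>) \<le> \<sigma> * real n" for n
    using \<sigma> by simp
  show ?thesis
  proof (cases "\<delta> > \<gamma> * \<sigma>")
    case True
    have "alpha lact ract w \<sigma> lam \<delta> \<le> ereal 0"
    proof (rule alpha_le[where B = "\<lambda>n. \<delta> / (\<delta> - \<gamma> * \<sigma>)" and b = "\<lambda>n. log ?q (\<delta> / (\<delta> - \<gamma> * \<sigma>))"])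
      show "\<forall>\<^sub>F n in sequentially. \<forall>d\<ge>\<delta> * real n.
        real (max_code_size lact ract w n (nat \<lfloor>\<sigma> * real n\<rfloor>) (nat \<lfloor>lam * real n\<rfloor>) d)
          \<le> \<delta> / (\<delta> - \<gamma> * \<sigma>)"
        using eventually_gt_at_top[of 0]
      proof eventually_elim
        case (elim n)
        show ?case
        proof (intro allI impI)
          fix d assume d: "\<delta> * real n \<le> d"
          let ?s = "nat \<lfloor>\<sigma> * real n\<rfloor>"
          have s: "\<gamma> * real ?s \<le> \<gamma> * \<sigma> * real n"
            using s_le[of n] assms(3) by (simp add: mult.assoc)
          have lt: "\<gamma> * \<sigma> * real n < \<delta> * real n" using True elim by simp
          \<comment> \<open>Here \<open>t = s\<close>: no coordinate is fixed, and the plain Plotkin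
            bound is independent of \<open>n\<close>.\<close>
          have "real (max_code_size lact ract w n ?s (nat \<lfloor>lam * real n\<rfloor>) d)
              \<le> ?q ^ (?s - ?s) * (\<delta> * real n / (\<delta> * real n - \<gamma> * real ?s))"
            by (rule max_code_size_le[OF assms(1,2) _ d]) (use s lt assms(3) in linarith)+
          also have "\<dots> \<le> \<delta> * real n / (\<delta> * real n - \<gamma> * \<sigma> * real n)"
            using s lt assms(4) by (simp add: frac_le)
          also have "\<dots> = (\<delta> * real n) / ((\<delta> - \<gamma> * \<sigma>) * real n)" by (simp add: algebra_simps)
          also have "\<dots> = \<delta> / (\<delta> - \<gamma> * \<sigma>)" using elim by simp
          finally show "real (max_code_size lact ract w n ?s (nat \<lfloor>lam * real n\<rfloor>) d)
              \<le> \<delta> / (\<delta> - \<gamma> * \<sigma>)" .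
        qed
      qed
      show "(\<lambda>n. log ?q (\<delta> / (\<delta> - \<gamma> * \<sigma>)) / real n) \<longlonglongrightarrow> 0"
        by (rule lim_const_over_n)
    qed simp
    then show ?thesis using True by (simp add: zero_ereal_def)
  next
    case False
    define s where "s n = nat \<lfloor>\<sigma> * real n\<rfloor>" for n
    \<comment> \<open>The subtracted 1 keeps \<open>\<gamma> * real (t n)\<close> at least \<gamma>
      below \<open>\<delta> * real n\<close> for large \<open>n\<close>. The Plotkin factor is then
      at most linear in \<open>n\<close> and does not affect the exponent.\<close>
    define t where "t n = nat \<lfloor>\<delta> / \<gamma> * real n - 1\<rfloor>" for n
    have le: "\<delta> / \<gamma> \<le> \<sigma>" using False assms(3) by (simp add: field_simps)
    have le_n: "\<delta> / \<gamma> * real n \<le> \<sigma> * real n" for n using le by (rule mult_right_mono) simp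
    have t_le_s: "t n \<le> s n" for n
      unfolding t_def s_def using le_n[of n] by (intro nat_mono floor_mono) simp
    have pos: "\<delta> / \<gamma> > 0" using assms(3,4) by simp
    \<comment> \<open>From here on \<open>nat\<close> in \<open>t n\<close> does not truncate a
      negative number.\<close>
    have large: "\<forall>\<^sub>F n in sequentially. \<delta> / \<gamma> * real n \<ge> 1"
      using pos by real_asymp
    have "alpha lact ract w \<sigma> lam \<delta> \<le> ereal (\<sigma> - \<delta> / \<gamma>)"
    proof (rule alpha_le[where B = "\<lambda>n. ?q ^ (s n - t n) * (\<delta> / \<gamma> * real n)"
          and b = "\<lambda>n. \<sigma> * real n - \<delta> / \<gamma> * real n + 2 + log ?q (\<delta> / \<gamma> * real n)"])
      show "\<forall>\<^sub>F n in sequentially. \<forall>d\<ge>\<delta> * real n.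
        real (max_code_size lact ract w n (nat \<lfloor>\<sigma> * real n\<rfloor>) (nat \<lfloor>lam * real n\<rfloor>) d)
          \<le> ?q ^ (s n - t n) * (\<delta> / \<gamma> * real n)"
        using large
      proof eventually_elim
        case (elim n)
        show ?case
        proof (intro allI impI)
          fix d assume d: "\<delta> * real n \<le> d"
          have "real (t n) \<le> \<delta> / \<gamma> * real n - 1" unfolding t_def using elim by simp
          then have "\<gamma> * real (t n) \<le> \<gamma> * (\<delta> / \<gamma> * real n - 1)" using assms(3) by simp
          also have "\<dots> = \<delta> * real n - \<gamma>" using assms(3) by (simp add: field_simps)
          finally have t: "\<gamma> \<le> \<delta> * real n - \<gamma> * real (t n)" by simp
          have "real (max_code_size lact ract w n (s n) (nat \<lfloor>lam * real n\<rfloor>) d)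
              \<le> ?q ^ (s n - t n) * (\<delta> * real n / (\<delta> * real n - \<gamma> * real (t n)))"
            by (rule max_code_size_le[OF assms(1,2) _ d t_le_s]) (use t assms(3) in auto)
          also have "\<dots> \<le> ?q ^ (s n - t n) * (\<delta> * real n / \<gamma>)"
            using t assms by (intro mult_left_mono divide_left_mono mult_pos_pos) auto
          finally show "real (max_code_size lact ract w n (nat \<lfloor>\<sigma> * real n\<rfloor>) (nat \<lfloor>lam * real n\<rfloor>) d)
              \<le> ?q ^ (s n - t n) * (\<delta> / \<gamma> * real n)" by (simp add: s_def)
        qed
      qed
      show "\<forall>\<^sub>F n in sequentially. log ?q (?q ^ (s n - t n) * (\<delta> / \<gamma> * real n))
          \<le> \<sigma> * real n - \<delta> / \<gamma> * real n + 2 + log ?q (\<delta> / \<gamma> * real n)"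
        using large
      proof eventually_elim
        case (elim n)
        show ?case
        proof (cases "?q = 1")
          \<comment> \<open>To base 1 every \<open>log\<close> is 0, and the rest of the right side
            is at least 2.\<close>
          case True
          then show ?thesis using le_n[of n] by (simp add: log_def)
        next
          case False
          have "card (UNIV :: 'a set) > 0" by (simp add: card_gt_0_iff)
          then have q: "?q > 1" using False by linarith
          have "\<delta> / \<gamma> * real n > 0" using elim by linarith
          then have "log ?q (?q ^ (s n - t n) * (\<delta> / \<gamma> * real n))
              = real (s n - t n) + log ?q (\<delta> / \<gamma> * real n)"
            using q by (subst log_mult) (auto simp: log_nat_power)
          \<comment> \<open>The 2 in \<open>b\<close> comes from here: 1 is subtracted in
            \<open>t\<close>, and the floor loses less than 1.\<close>
          moreover have "real (t n) \<ge> \<delta> / \<gamma> * real n - 2"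
            unfolding t_def using elim by linarith
          ultimately show ?thesis using s_le[of n] t_le_s[of n] by (simp add: s_def of_nat_diff)
        qed
      qed
      show "(\<lambda>n. (\<sigma> * real n - \<delta> / \<gamma> * real n + 2 + log ?q (\<delta> / \<gamma> * real n)) / real n)
          \<longlonglongrightarrow> \<sigma> - \<delta> / \<gamma>"
        using pos by (rule linear_plus_log_over_n_tendsto)
    qed
    then show ?thesis using False by simp
  qed
qed

end
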